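(* Let $N\ge 2$ be an integer, let $\{(t_n,x_n): n=0,1,\dots,N\}\subset\mathbb{R}^2$ be a data set with $t_0<t_1<\dots<t_N$, and put $I=[t_0,t_N]$ and $I_n=[t_{n-1},t_n]$ for $n=1,\dots,N$. For each $n=1,\dots,N$ let $L_n:I\to I_n$ be a contractive homeomorphism with $L_n(t_0)=t_{n-1}$ and $L_n(t_N)=t_n$, and let $F_n:I\times\mathbb{R}\to\mathbb{R}$ be a continuous function that is contractive in its second argument and satisfies $F_n(t_0,x_0)=x_{n-1}$ and $F_n(t_N,x_N)=x_n$. Let $f:I\to\mathbb{R}$ be the fractal interpolation function of the data set associated with the iterated function system $\{(L_n(t),F_n(t,x)): n=1,\dots,N\}$. Then $$f(t)=F_n\bigl(L_n^{-1}(t),\,f(L_n^{-1}(t))\bigr)\qquad\text{for all } t\in I_n,\ n=1,2,\dots,N.$$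
   Context: "Contractive in its second argument" means there is a constant $\delta_n\in[0,1)$ with $|F_n(t,x)-F_n(t,y)|\le\delta_n|x-y|$ for all $t\in I$ and $x,y\in\mathbb{R}$. (The usual choice is $F_n(t,x)=\alpha_n x+q_n(t)$ with a vertical scaling factor $\alpha_n\in(-1,1)$ and $q_n$ continuous on $I$.) The iterated function system consists of the maps $w_n:I\times\mathbb{R}\to I\times\mathbb{R}$, $w_n(t,x)=(L_n(t),F_n(t,x))$, $n=1,\dots,N$. Its attractor is the unique nonempty compact set $A\subset I\times\mathbb{R}$ with $A=\bigcup_{n=1}^N w_n(A)$. The fractal interpolation function associated with this system is the continuous function $f:I\to\mathbb{R}$ that interpolates the data, i.e. $f(t_n)=x_n$ for $n=0,\dots,N$, and whose graph is the attractor of the system. *)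

theory Defs
  imports "HOL-Analysis.Analysis"
begin

definition contractive_on :: "'a::metric_space set \<Rightarrow> ('a \<Rightarrow> 'b::metric_space) \<Rightarrow> bool" where
  "contractive_on S g \<longleftrightarrow> (\<exists>c<1. c-lipschitz_on S g)"

text \<open>The constant is uniform in the first argument.\<close>

definition contractive_snd_on :: "real set \<Rightarrow> (real \<times> real \<Rightarrow> real) \<Rightarrow> bool" where
  "contractive_snd_on I F \<longleftrightarrow>
     (\<exists>\<delta>\<in>{0..<1}. \<forall>t\<in>I. \<forall>x y. \<bar>F (t, x) - F (t, y)\<bar> \<le> \<delta> * \<bar>x - y\<bar>)"

definition ifs_map :: "(real \<Rightarrow> real) \<Rightarrow> (real \<times> real \<Rightarrow> real) \<Rightarrow> real \<times> real \<Rightarrow> real \<times> real" where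
  "ifs_map L F = (\<lambda>(t, x). (L t, F (t, x)))"

definition compact_invariant ::
  "'a::topological_space set \<Rightarrow> 'i set \<Rightarrow> ('i \<Rightarrow> 'a \<Rightarrow> 'a) \<Rightarrow> 'a set \<Rightarrow> bool" where
  "compact_invariant X J w A \<longleftrightarrow>
     A \<noteq> {} \<and> compact A \<and> A \<subseteq> X \<and> A = (\<Union>n\<in>J. w n ` A)"

definition is_attractor ::
  "'a::topological_space set \<Rightarrow> 'i set \<Rightarrow> ('i \<Rightarrow> 'a \<Rightarrow> 'a) \<Rightarrow> 'a set \<Rightarrow> bool" where
  "is_attractor X J w A \<longleftrightarrow>
     compact_invariant X J w A \<and> (\<forall>B. compact_invariant X J w B \<longrightarrow> B = A)"

text \<open>
  The function \<open>f\<close> lives on the interval from \<open>t 0\<close> to \<open>t N\<close>; being a total HOL function it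
  also has values elsewhere, which play no role.
\<close>

definition fractal_interpolation_function ::
  "nat \<Rightarrow> (nat \<Rightarrow> real) \<Rightarrow> (nat \<Rightarrow> real) \<Rightarrow> (nat \<Rightarrow> real \<Rightarrow> real) \<Rightarrow>
   (nat \<Rightarrow> real \<times> real \<Rightarrow> real) \<Rightarrow> (real \<Rightarrow> real) \<Rightarrow> bool" where
  "fractal_interpolation_function N t x L F f \<longleftrightarrow>
     continuous_on {t 0..t N} f \<and>
     (\<forall>n\<le>N. f (t n) = x n) \<and>
     is_attractor ({t 0..t N} \<times> UNIV) {1..N} (\<lambda>n. ifs_map (L n) (F n))
       ((\<lambda>s. (s, f s)) ` {t 0..t N})"

end

theory Submission
  imports Defs
begin

text \<open>
  The graph of \<open>f\<close> is the attractor, so it is mapped into itself by every \<open>w\<^sub>n\<close>: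
  the image of \<open>(u, f u)\<close> with \<open>u = L\<^sub>n\<^sup>-\<^sup>1 s\<close> is a point of the graph above \<open>s\<close>.
\<close>

theorem theorem3p1:
  fixes N :: nat
    and t x :: "nat \<Rightarrow> real"
    and L :: "nat \<Rightarrow> real \<Rightarrow> real"
    and F :: "nat \<Rightarrow> real \<times> real \<Rightarrow> real"
    and f :: "real \<Rightarrow> real"
  assumes "N \<ge> 2"
    and "\<forall>n\<in>{1..N}. t (n - 1) < t n"
    and "\<forall>n\<in>{1..N}. \<exists>g. homeomorphism {t 0..t N} {t (n - 1)..t n} (L n) g"
    and "\<forall>n\<in>{1..N}. contractive_on {t 0..t N} (L n)"
    and "\<forall>n\<in>{1..N}. L n (t 0) = t (n - 1) \<and> L n (t N) = t n"
    and "\<forall>n\<in>{1..N}. continuous_on ({t 0..t N} \<times> UNIV) (F n)"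
    and "\<forall>n\<in>{1..N}. contractive_snd_on {t 0..t N} (F n)"
    and "\<forall>n\<in>{1..N}. F n (t 0, x 0) = x (n - 1) \<and> F n (t N, x N) = x n"
    and "fractal_interpolation_function N t x L F f"
  shows "\<forall>n\<in>{1..N}. \<forall>s\<in>{t (n - 1)..t n}.
           f s = F n (inv_into {t 0..t N} (L n) s, f (inv_into {t 0..t N} (L n) s))"
proof (intro ballI)
  fix n s
  assume n: "n \<in> {1..N}" and s: "s \<in> {t (n - 1)..t n}"
  let ?G = "(\<lambda>s. (s, f s)) ` {t 0..t N}"
  define u where "u = inv_into {t 0..t N} (L n) s"
  \<comment> \<open>\<open>inv_into\<close> is a choice operator, with a guaranteed value only on
    the image of \<open>L n\<close>. Surjectivity of the homeomorphism onto the subinterval puts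
    \<open>s\<close> in that image, so \<open>u\<close> is a genuine preimage.\<close>
  have "L n ` {t 0..t N} = {t (n - 1)..t n}"
    using assms(3) n unfolding homeomorphism_def by blast
  with s have u: "u \<in> {t 0..t N}" and Lu: "L n u = s"
    unfolding u_def by (metis inv_into_into, metis f_inv_into_f)
  have "?G = (\<Union>n\<in>{1..N}. ifs_map (L n) (F n) ` ?G)"
    using assms(9)
    unfolding fractal_interpolation_function_def is_attractor_def compact_invariant_def by blast
  moreover have "(u, f u) \<in> ?G"
    using u by blast
  ultimately have "ifs_map (L n) (F n) (u, f u) \<in> ?G"
    using n by blast
  then have "(s, F n (u, f u)) \<in> ?G"
    by (simp add: ifs_map_def Lu)
  \<comment> \<open>A graph has at most one point with first coordinate \<open>s\<close>, namely
    \<open>(s, f s)\<close>, so comparing second coordinates gives the equation.\<close>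
  then show "f s = F n (inv_into {t 0..t N} (L n) s, f (inv_into {t 0..t N} (L n) s))"
    unfolding u_def by auto
qed

end
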